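(* Let $(\mathfrak{g},\langle\cdot,\cdot\rangle)$ be a completely solvable unimodular Lorentzian Lie algebra whose center $Z(\mathfrak{g})$ is nonzero and degenerate (the restriction of $\langle\cdot,\cdot\rangle$ to it is degenerate). Then $\mathfrak{g}$ is Einstein if and only if it is (isometrically isomorphic to a Lorentzian Lie algebra) obtained by a double extension process from an abelian Euclidean Lie algebra with admissible parameters $(K,D,0,b)$. In particular, if $\mathfrak{g}$ is Einstein then it is Ricci-flat.
   Context: A Lorentzian Lie algebra is a finite-dimensional real Lie algebra with a nondegenerate symmetric bilinear form of signature $(1,n-1)$. $\mathfrak{g}$ is completely solvable if there is a chain of ideals $0=I_0\subset I_1\subset\cdots\subset I_n=\mathfrak{g}$ with $\dim I_i=i$; unimodular means $\mathrm{tr}(\mathrm{ad}_u)=0$ for all $u$. Double extension of a Euclidean Lie algebra $(\mathfrak{g}_0,[\cdot,\cdot]_0,\langle\cdot,\cdot\rangle_0)$ with parameters $(K,D,\mu,b)$ ($K,D$ endomorphisms of $\mathfrak{g}_0$, $K$ skew-symmetric, $\mu\in\mathbb{R}$, $b\in\mathfrak{g}_0$): $\mathfrak{g}=\mathbb{R}e\oplus\mathfrak{g}_0\oplus\mathbb{R}\bar e$ with $\langle e,e\rangle=\langle\bar e,\bar e\rangle=0$, $\langle e,\bar e\rangle=1$, $\mathfrak{g}_0\perp\{e,\bar e\}$, $\langle\cdot,\cdot\rangle|_{\mathfrak{g}_0}=\langle\cdot,\cdot\rangle_0$, and skew-symmetric bracket $[\bar e,e]=\mu e$, $[\bar e,u]=D(u)+\langle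 b,u\rangle_0e$, $[u,v]=[u,v]_0+\langle K(u),v\rangle_0e$, $[e,u]=0$ ($u,v\in\mathfrak{g}_0$). For $\mathfrak{g}_0$ abelian, the parameters are called admissible when this bracket is a Lie bracket and the resulting Lorentzian Lie algebra is Einstein; equivalently, $KD+D^*K=\mu K$ and $4\mu\,\mathrm{tr}(D)-2\mathrm{tr}(D^2)-2\mathrm{tr}(DD^* )-\mathrm{tr}(K^2)=0$ (adjoints with respect to $\langle\cdot,\cdot\rangle_0$). Einstein means the Ricci operator $\mathrm{Ric}$ of the Levi-Civita connection (given by $2\langle \mathrm{L}_uv,w\rangle=\langle[u,v],w\rangle+\langle[w,u],v\rangle+\langle[w,v],u\rangle$, curvature $\mathrm{L}_{[u,v]}-[\mathrm{L}_u,\mathrm{L}_v]$, $\langle\mathrm{Ric}(u),v\rangle=\mathrm{tr}(w\mapsto K(u,w)v)$) equals $\lambda\mathrm{Id}$ for some $\lambda$; Ricci-flat means $\mathrm{Ric}=0$. *)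

theory Defs
  imports "HOL-Analysis.Analysis"
begin

definition bilinear_on :: "'a::real_vector set \<Rightarrow> ('a \<Rightarrow> 'a \<Rightarrow> 'b::real_vector) \<Rightarrow> bool" where
  "bilinear_on S f \<longleftrightarrow>
     (\<forall>x\<in>S. \<forall>y\<in>S. \<forall>z\<in>S. \<forall>c::real.
        f (x + y) z = f x z + f y z \<and> f z (x + y) = f z x + f z y \<and>
        f (c *\<^sub>R x) z = c *\<^sub>R f x z \<and> f z (c *\<^sub>R x) = c *\<^sub>R f z x)"

definition endo_on :: "'a::real_vector set \<Rightarrow> ('a \<Rightarrow> 'a) \<Rightarrow> bool" where
  "endo_on S f \<longleftrightarrow> (\<forall>x\<in>S. f x \<in> S) \<and>
     (\<forall>x\<in>S. \<forall>y\<in>S. \<forall>c::real. f (x + y) = f x + f y \<and> f (c *\<^sub>R x) = c *\<^sub>R f x)"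

text \<open>A fixed orthonormal basis (w.r.t. the ambient inner product) of a subspace, used only to
  compute traces; the trace of an endomorphism does not depend on the chosen basis.\<close>
definition obasis :: "'a::euclidean_space set \<Rightarrow> 'a set" where
  "obasis S = (SOME E. E \<subseteq> S \<and> pairwise orthogonal E \<and> (\<forall>x\<in>E. norm x = 1) \<and>
                        independent E \<and> span E = S)"

definition trace_on :: "'a::euclidean_space set \<Rightarrow> ('a \<Rightarrow> 'a) \<Rightarrow> real" where
  "trace_on S f = (\<Sum>b\<in>obasis S. inner (f b) b)"

definition lie_algebra_on :: "'a::real_vector set \<Rightarrow> ('a \<Rightarrow> 'a \<Rightarrow> 'a) \<Rightarrow> bool" where
  "lie_algebra_on S br \<longleftrightarrow> subspace S \<and> (\<forall>x\<in>S. \<forall>y\<in>S. br x y \<in> S) \<and> bilinear_on S br \<and>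
     (\<forall>x\<in>S. \<forall>y\<in>S. br x y = - br y x) \<and>
     (\<forall>x\<in>S. \<forall>y\<in>S. \<forall>z\<in>S. br x (br y z) + br y (br z x) + br z (br x y) = 0)"

definition sym_form_on :: "'a::real_vector set \<Rightarrow> ('a \<Rightarrow> 'a \<Rightarrow> real) \<Rightarrow> bool" where
  "sym_form_on S B \<longleftrightarrow> bilinear_on S B \<and> (\<forall>x\<in>S. \<forall>y\<in>S. B x y = B y x)"

text \<open>Nondegenerate symmetric bilinear form of signature (1, n-1), n = dim S:
  there is a B-orthogonal basis f 0, ..., f (n-1) of S with B(f 0, f 0) = -1 and B(f i, f i) = 1
  for i > 0 (Sylvester).\<close>
definition lorentzian_on :: "'a::euclidean_space set \<Rightarrow> ('a \<Rightarrow> 'a \<Rightarrow> real) \<Rightarrow> bool" where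
  "lorentzian_on S B \<longleftrightarrow> sym_form_on S B \<and>
     (\<exists>f::nat \<Rightarrow> 'a. (\<forall>i<dim S. f i \<in> S) \<and> inj_on f {..<dim S} \<and>
        independent (f ` {..<dim S}) \<and> span (f ` {..<dim S}) = S \<and>
        (\<forall>i<dim S. \<forall>j<dim S. B (f i) (f j) = (if i \<noteq> j then 0 else if i = 0 then -1 else 1)))"

definition euclidean_form_on :: "'a::real_vector set \<Rightarrow> ('a \<Rightarrow> 'a \<Rightarrow> real) \<Rightarrow> bool" where
  "euclidean_form_on S ip \<longleftrightarrow> sym_form_on S ip \<and> (\<forall>x\<in>S. x \<noteq> 0 \<longrightarrow> ip x x > 0)"

definition is_ideal :: "'a::real_vector set \<Rightarrow> ('a \<Rightarrow> 'a \<Rightarrow> 'a) \<Rightarrow> 'a set \<Rightarrow> bool" where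
  "is_ideal S br I \<longleftrightarrow> subspace I \<and> I \<subseteq> S \<and> (\<forall>x\<in>S. \<forall>y\<in>I. br x y \<in> I)"

definition completely_solvable_on :: "'a::euclidean_space set \<Rightarrow> ('a \<Rightarrow> 'a \<Rightarrow> 'a) \<Rightarrow> bool" where
  "completely_solvable_on S br \<longleftrightarrow>
     (\<exists>I::nat \<Rightarrow> 'a set. I 0 = {0} \<and> I (dim S) = S \<and>
        (\<forall>i\<le>dim S. is_ideal S br (I i) \<and> dim (I i) = i) \<and>
        (\<forall>i<dim S. I i \<subseteq> I (Suc i)))"

definition unimodular_on :: "'a::euclidean_space set \<Rightarrow> ('a \<Rightarrow> 'a \<Rightarrow> 'a) \<Rightarrow> bool" where
  "unimodular_on S br \<longleftrightarrow> (\<forall>u\<in>S. trace_on S (br u) = 0)"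

definition center_on :: "'a::real_vector set \<Rightarrow> ('a \<Rightarrow> 'a \<Rightarrow> 'a) \<Rightarrow> 'a set" where
  "center_on S br = {z\<in>S. \<forall>x\<in>S. br z x = 0}"

definition degenerate_on :: "'a::real_vector set \<Rightarrow> ('a \<Rightarrow> 'a \<Rightarrow> real) \<Rightarrow> bool" where
  "degenerate_on Z B \<longleftrightarrow> (\<exists>z\<in>Z. z \<noteq> 0 \<and> (\<forall>w\<in>Z. B z w = 0))"

definition LC :: "'a set \<Rightarrow> ('a \<Rightarrow> 'a \<Rightarrow> 'a) \<Rightarrow> ('a \<Rightarrow> 'a \<Rightarrow> real) \<Rightarrow> 'a \<Rightarrow> 'a \<Rightarrow> 'a" where
  "LC S br B u v = (THE x. x \<in> S \<and>
      (\<forall>w\<in>S. 2 * B x w = B (br u v) w + B (br w u) v + B (br w v) u))"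

definition curv :: "'a::real_vector set \<Rightarrow> ('a \<Rightarrow> 'a \<Rightarrow> 'a) \<Rightarrow> ('a \<Rightarrow> 'a \<Rightarrow> real) \<Rightarrow> 'a \<Rightarrow> 'a \<Rightarrow> 'a \<Rightarrow> 'a" where
  "curv S br B u w v = LC S br B (br u w) v - (LC S br B u (LC S br B w v) - LC S br B w (LC S br B u v))"

definition ricci_op :: "'a::euclidean_space set \<Rightarrow> ('a \<Rightarrow> 'a \<Rightarrow> 'a) \<Rightarrow> ('a \<Rightarrow> 'a \<Rightarrow> real) \<Rightarrow> 'a \<Rightarrow> 'a" where
  "ricci_op S br B u = (THE x. x \<in> S \<and> (\<forall>v\<in>S. B x v = trace_on S (\<lambda>w. curv S br B u w v)))"

definition einstein_on :: "'a::euclidean_space set \<Rightarrow> ('a \<Rightarrow> 'a \<Rightarrow> 'a) \<Rightarrow> ('a \<Rightarrow> 'a \<Rightarrow> real) \<Rightarrow> bool" where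
  "einstein_on S br B \<longleftrightarrow> (\<exists>c::real. \<forall>u\<in>S. ricci_op S br B u = c *\<^sub>R u)"

definition ricci_flat_on :: "'a::euclidean_space set \<Rightarrow> ('a \<Rightarrow> 'a \<Rightarrow> 'a) \<Rightarrow> ('a \<Rightarrow> 'a \<Rightarrow> real) \<Rightarrow> bool" where
  "ricci_flat_on S br B \<longleftrightarrow> (\<forall>u\<in>S. ricci_op S br B u = 0)"

text \<open>An element (s, u, t) stands for s e + u + t ebar, with u in the carrier U of g0.\<close>
definition dext_carrier :: "'a set \<Rightarrow> (real \<times> 'a \<times> real) set" where
  "dext_carrier U = {(s, u, t). u \<in> U}"

definition dext_form :: "('a \<Rightarrow> 'a \<Rightarrow> real) \<Rightarrow> real \<times> 'a \<times> real \<Rightarrow> real \<times> 'a \<times> real \<Rightarrow> real" where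
  "dext_form ip0 x y = (case x of (s1, u1, t1) \<Rightarrow> case y of (s2, u2, t2) \<Rightarrow>
       s1 * t2 + t1 * s2 + ip0 u1 u2)"

text \<open>Bilinear extension of [ebar,e] = mu e, [ebar,u] = D u + <b,u>_0 e,
  [u,v] = [u,v]_0 + <K u, v>_0 e, [e,u] = 0, skew-symmetric.\<close>
definition dext_br :: "('a::real_vector \<Rightarrow> 'a \<Rightarrow> real) \<Rightarrow> ('a \<Rightarrow> 'a \<Rightarrow> 'a) \<Rightarrow> ('a \<Rightarrow> 'a) \<Rightarrow> ('a \<Rightarrow> 'a) \<Rightarrow>
     real \<Rightarrow> 'a \<Rightarrow> real \<times> 'a \<times> real \<Rightarrow> real \<times> 'a \<times> real \<Rightarrow> real \<times> 'a \<times> real" where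
  "dext_br ip0 br0 K D \<mu> b x y = (case x of (s1, u1, t1) \<Rightarrow> case y of (s2, u2, t2) \<Rightarrow>
      (\<mu> * t1 * s2 - \<mu> * s1 * t2 + t1 * ip0 b u2 - t2 * ip0 b u1 + ip0 (K u1) u2,
       t1 *\<^sub>R D u2 - t2 *\<^sub>R D u1 + br0 u1 u2,
       0))"

definition admissible :: "'a::euclidean_space set \<Rightarrow> ('a \<Rightarrow> 'a \<Rightarrow> real) \<Rightarrow> ('a \<Rightarrow> 'a) \<Rightarrow> ('a \<Rightarrow> 'a) \<Rightarrow>
     real \<Rightarrow> 'a \<Rightarrow> bool" where
  "admissible U ip0 K D \<mu> b \<longleftrightarrow>
     endo_on U K \<and> endo_on U D \<and> (\<forall>u\<in>U. \<forall>v\<in>U. ip0 (K u) v = - ip0 u (K v)) \<and> b \<in> U \<and>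
     lie_algebra_on (dext_carrier U) (dext_br ip0 (\<lambda>_ _. 0) K D \<mu> b) \<and>
     lorentzian_on (dext_carrier U) (dext_form ip0) \<and>
     einstein_on (dext_carrier U) (dext_br ip0 (\<lambda>_ _. 0) K D \<mu> b) (dext_form ip0)"

definition isometric_iso_on ::
  "'a::real_vector set \<Rightarrow> ('a \<Rightarrow> 'a \<Rightarrow> 'a) \<Rightarrow> ('a \<Rightarrow> 'a \<Rightarrow> real) \<Rightarrow>
   'b::real_vector set \<Rightarrow> ('b \<Rightarrow> 'b \<Rightarrow> 'b) \<Rightarrow> ('b \<Rightarrow> 'b \<Rightarrow> real) \<Rightarrow> ('a \<Rightarrow> 'b) \<Rightarrow> bool" where
  "isometric_iso_on S1 br1 B1 S2 br2 B2 \<phi> \<longleftrightarrow>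
     bij_betw \<phi> S1 S2 \<and>
     (\<forall>x\<in>S1. \<forall>y\<in>S1. \<forall>c::real. \<phi> (x + y) = \<phi> x + \<phi> y \<and> \<phi> (c *\<^sub>R x) = c *\<^sub>R \<phi> x) \<and>
     (\<forall>x\<in>S1. \<forall>y\<in>S1. \<phi> (br1 x y) = br2 (\<phi> x) (\<phi> y) \<and> B2 (\<phi> x) (\<phi> y) = B1 x y)"

end

theory Submission
  imports Defs
begin

text \<open>For a unimodular algebra \<open>ric u v = - tr (R u \<circ> R v)\<close> with \<open>R u w = L w u\<close>. Choose a
  null central vector \<open>e\<close>, a null vector \<open>h\<close> with \<open>B e h = 1\<close> and an orthonormal basis \<open>E\<close> of
  \<open>{e, h}\<^sup>\<bottom>\<close>. Then \<open>ric e e = 0\<close> says that a sum of squares vanishes and makes \<open>e\<^sup>\<bottom>\<close> a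
  subalgebra, and \<open>ric e h = 0\<close> follows, so the Einstein constant is zero. Summing
  \<open>ric u u = 0\<close> over \<open>u \<in> E\<close> gives
  \<open>(\<Sum>u,i,j\<in>E. (B (br u i) j)\<^sup>2) + 2 * (\<Sum>u\<in>E. tr (ad u \<circ> ad u)) = 0\<close>, where complete
  solvability makes every term nonnegative; hence \<open>e\<^sup>\<bottom>\<close> is an ideal and \<open>e\<^sup>\<bottom> / \<real>e\<close> is
  abelian. The converse is the invariance of the Ricci operator under isometric isomorphisms.\<close>

section \<open>Traces\<close>

lemma obasis_props:
  fixes S :: "'a::euclidean_space set"
  assumes "subspace S"
  shows "obasis S \<subseteq> S" "finite (obasis S)"
    and "\<And>v. v \<in> S \<Longrightarrow> (\<Sum>b\<in>obasis S. inner v b *\<^sub>R b) = v"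
proof -
  have ex: "\<exists>E. E \<subseteq> S \<and> pairwise orthogonal E \<and> (\<forall>x\<in>E. norm x = 1) \<and> independent E \<and> span E = S"
    using orthonormal_basis_subspace[OF assms] by metis
  have P: "obasis S \<subseteq> S \<and> pairwise orthogonal (obasis S) \<and> (\<forall>x\<in>obasis S. norm x = 1) \<and>
      independent (obasis S) \<and> span (obasis S) = S"
    unfolding obasis_def by (rule someI_ex[OF ex])
  show "obasis S \<subseteq> S" using P by blast
  show fin: "finite (obasis S)" using P independent_imp_finite by blast
  show "(\<Sum>b\<in>obasis S. inner v b *\<^sub>R b) = v" if "v \<in> S" for v
    by (rule orthonormal_basis_expand) (use P fin that in auto)
qed

text \<open>\<open>trace_on\<close> is computed in a basis orthonormal for the ambient inner
  product, while the frames below are adapted to \<open>B\<close> or to a flag. This moves the trace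
  to any resolution of the identity: expand \<open>A b\<close> along the \<open>x i\<close>, swap
  the sums, and resum each \<open>x i\<close> over the orthonormal basis.\<close>

lemma trace_on_UNIV_coords:
  fixes A :: "'a::euclidean_space \<Rightarrow> 'a"
  assumes A: "linear A" and c: "\<And>i. i \<in> I \<Longrightarrow> linear (c i)"
    and v: "\<And>v. v = (\<Sum>i\<in>I. c i v *\<^sub>R x i)"
  shows "trace_on UNIV A = (\<Sum>i\<in>I. c i (A (x i)))"
proof -
  let ?O = "obasis (UNIV :: 'a set)"
  note O = obasis_props[OF subspace_UNIV]
  have "inner (A b) b = (\<Sum>i\<in>I. c i (A b) * inner (x i) b)" for b
    by (subst v[of "A b"]) (simp add: inner_sum_left)
  then have "trace_on UNIV A = (\<Sum>i\<in>I. \<Sum>b\<in>?O. c i (A b) * inner (x i) b)"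
    unfolding trace_on_def by (simp add: sum.swap[of _ I])
  also have "\<dots> = (\<Sum>i\<in>I. c i (A (x i)))"
  proof (rule sum.cong[OF refl])
    fix i assume i: "i \<in> I"
    have "c i (A (x i)) = c i (A (\<Sum>b\<in>?O. inner (x i) b *\<^sub>R b))"
      by (simp add: O)
    also have "\<dots> = (\<Sum>b\<in>?O. inner (x i) b * c i (A b))"
      by (simp add: linear_sum[OF A] linear_sum[OF c[OF i]] linear_scale[OF A] linear_scale[OF c[OF i]])
    finally show "(\<Sum>b\<in>?O. c i (A b) * inner (x i) b) = c i (A (x i))"
      by (simp add: mult.commute)
  qed
  finally show ?thesis .
qed

text \<open>The preimages under \<open>\<phi>\<close> of the orthonormal basis of \<open>S\<close>
  are the vectors to which \<open>trace_on_UNIV_coords\<close> is applied.\<close>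

lemma trace_on_transport:
  fixes A :: "'a::euclidean_space \<Rightarrow> 'a" and \<phi> :: "'a \<Rightarrow> 'b::euclidean_space"
  assumes A: "linear A" and \<phi>: "linear \<phi>" "bij_betw \<phi> UNIV S"
    and A': "\<And>w. A' (\<phi> w) = \<phi> (A w)"
  shows "trace_on S A' = trace_on UNIV A"
proof -
  have S: "subspace S"
    using \<phi> linear_subspace_image[OF \<phi>(1) subspace_UNIV] by (simp add: bij_betw_def)
  note O = obasis_props[OF S]
  define \<psi> where "\<psi> = inv \<phi>"
  have inj: "inj \<phi>" and ran: "\<And>v. \<phi> v \<in> S" using \<phi>(2) by (auto simp: bij_betw_def)
  have \<psi>: "\<phi> (\<psi> b) = b" if "b \<in> S" for b
    using \<phi>(2) that unfolding \<psi>_def bij_betw_def by (metis f_inv_into_f)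
  have "trace_on UNIV A = (\<Sum>b\<in>obasis S. inner (\<phi> (A (\<psi> b))) b)"
  proof (rule trace_on_UNIV_coords[OF A])
    show "linear (\<lambda>v. inner (\<phi> v) b)" for b
      using linear_add[OF \<phi>(1)] linear_scale[OF \<phi>(1)]
      by (intro linearI) (simp_all add: inner_add_left)
    fix v
    have "\<phi> (\<Sum>b\<in>obasis S. inner (\<phi> v) b *\<^sub>R \<psi> b) = (\<Sum>b\<in>obasis S. inner (\<phi> v) b *\<^sub>R \<phi> (\<psi> b))"
      by (simp add: linear_sum[OF \<phi>(1)] linear_scale[OF \<phi>(1)])
    also have "\<dots> = (\<Sum>b\<in>obasis S. inner (\<phi> v) b *\<^sub>R b)"
      by (rule sum.cong) (use O(1) \<psi> in auto)
    also have "\<dots> = \<phi> v" using O(3) ran by blast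
    finally show "v = (\<Sum>b\<in>obasis S. inner (\<phi> v) b *\<^sub>R \<psi> b)"
      using inj by (simp add: inj_eq)
  qed
  also have "\<dots> = trace_on S A'"
    unfolding trace_on_def
    by (rule sum.cong) (use O(1) \<psi> A' in \<open>metis subsetD\<close>)+
  finally show ?thesis by simp
qed

text \<open>An orthonormal basis adapted to the flag makes \<open>A\<close> triangular, so the
  diagonal of \<open>A \<circ> A\<close> consists of squares. Complete solvability enters the
  theorem only through this inequality, with \<open>A = br u\<close>.\<close>

lemma trace_square_nonneg_of_flag:
  fixes A :: "'a::euclidean_space \<Rightarrow> 'a" and I :: "nat \<Rightarrow> 'a set"
  defines "n \<equiv> DIM('a)"
  assumes A: "linear A" and I0: "I 0 = {0}" and In: "I n = UNIV"
    and sub: "\<And>i. i \<le> n \<Longrightarrow> subspace (I i)" and dim: "\<And>i. i \<le> n \<Longrightarrow> dim (I i) = i"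
    and inc: "\<And>i. i < n \<Longrightarrow> I i \<subseteq> I (Suc i)"
    and inv: "\<And>i x. i \<le> n \<Longrightarrow> x \<in> I i \<Longrightarrow> A x \<in> I i"
  shows "trace_on UNIV (\<lambda>w. A (A w)) \<ge> 0"
proof -
  have "\<exists>g. g \<in> I (Suc i) \<and> norm g = 1 \<and> (\<forall>y\<in>I i. inner y g = 0)" if i: "i < n" for i
  proof -
    have s: "span (I i) = I i" "span (I (Suc i)) = I (Suc i)"
      using sub i by (auto simp: span_eq_iff)
    have "I i \<noteq> I (Suc i)" using dim[of i] dim[of "Suc i"] i by auto
    then have "span (I i) \<subset> span (I (Suc i))" unfolding s using inc[OF i] by blast
    then obtain x where x: "x \<noteq> 0" "x \<in> span (I (Suc i))" "\<And>y. y \<in> span (I i) \<Longrightarrow> orthogonal x y"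
      using orthogonal_to_subspace_exists_gen by blast
    show ?thesis
      by (rule exI[of _ "x /\<^sub>R norm x"])
        (use x s sub[of "Suc i"] i in \<open>auto simp: subspace_scale orthogonal_def inner_commute\<close>)
  qed
  then obtain g where g: "\<And>i. i < n \<Longrightarrow> g i \<in> I (Suc i)" "\<And>i. i < n \<Longrightarrow> norm (g i) = 1"
      "\<And>i y. i < n \<Longrightarrow> y \<in> I i \<Longrightarrow> inner y (g i) = 0"
    by metis
  have gg: "inner (g i) (g i) = 1" if "i < n" for i
    using g(2)[OF that] by (simp add: dot_square_norm)
  \<comment> \<open>\<open>I k\<close> lies in the part of \<open>I (Suc k)\<close> orthogonal to
    \<open>g k\<close>. That part is a proper subspace, hence of dimension at most \<open>k\<close>,
    so the two agree.\<close>
  have proj: "v - inner v (g k) *\<^sub>R g k \<in> I k" if k: "k < n" and v: "v \<in> I (Suc k)" for k v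
  proof -
    let ?T = "{w \<in> I (Suc k). inner w (g k) = 0}"
    have sk: "subspace (I (Suc k))" using sub k by simp
    then have T: "subspace ?T"
      by (auto simp: subspace_def inner_add_left)
    have "g k \<notin> ?T" using gg[OF k] by simp
    then have "?T \<subset> I (Suc k)" using g(1)[OF k] by blast
    then have "dim ?T < dim (I (Suc k))"
      using T sk by (metis dim_psubset span_eq_iff)
    then have "dim ?T \<le> dim (I k)" using dim k by simp
    moreover have "I k \<subseteq> ?T" using inc[OF k] g(3)[OF k] by auto
    ultimately have "I k = ?T"
      using subspace_dim_equal sub[of k] T k by auto
    moreover have "v - inner v (g k) *\<^sub>R g k \<in> ?T"
      using v g(1)[OF k] sk gg[OF k] by (auto simp: inner_diff_left subspace_diff subspace_scale)
    ultimately show ?thesis by simp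
  qed
  have mono: "I i \<subseteq> I j" if "i \<le> j" "j \<le> n" for i j
    using that
  proof (induction j rule: dec_induct)
    case (step j)
    then show ?case using inc[of j] by simp
  qed simp
  have expand: "v = (\<Sum>i<k. inner v (g i) *\<^sub>R g i)" if "k \<le> n" "v \<in> I k" for k v
    using that
  proof (induction k arbitrary: v)
    case 0
    then show ?case using I0 by simp
  next
    case (Suc k)
    define w where "w = v - inner v (g k) *\<^sub>R g k"
    have w: "w \<in> I k" unfolding w_def using proj Suc.prems by simp
    have "inner (g k) (g i) = inner (g i) (g k)" for i by (rule inner_commute)
    moreover have "inner (g i) (g k) = 0" if "i < k" for i
      using g(1)[of i] g(3)[of k "g i"] mono[of "Suc i" k] that Suc.prems by auto
    ultimately have "inner w (g i) = inner v (g i)" if "i < k" for i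
      using that by (simp add: w_def inner_diff_left)
    then have "w = (\<Sum>i<k. inner v (g i) *\<^sub>R g i)"
      using Suc.IH[OF _ w] Suc.prems by simp
    then show ?case by (simp add: w_def algebra_simps)
  qed
  have "trace_on UNIV (\<lambda>w. A (A w)) = (\<Sum>i\<in>{..<n}. inner (A (A (g i))) (g i))"
    using A expand[of n] In
    by (intro trace_on_UNIV_coords[where c = "\<lambda>i v. inner v (g i)"] linearI)
      (auto simp: inner_add_left linear_add linear_scale)
  also have "\<dots> \<ge> 0"
  proof (rule sum_nonneg)
    fix i assume "i \<in> {..<n}"
    then have i: "i < n" by simp
    \<comment> \<open>\<open>a\<close> is the diagonal entry of \<open>A\<close> at
      \<open>g i\<close>. The remainder \<open>r\<close> stays in \<open>I i\<close> under
      \<open>A\<close>, so it adds nothing along \<open>g i\<close>.\<close>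
    define a where "a = inner (A (g i)) (g i)"
    define r where "r = A (g i) - a *\<^sub>R g i"
    have r: "r \<in> I i" unfolding r_def a_def using proj[OF i] inv g(1) i by simp
    have Ag: "A (g i) = a *\<^sub>R g i + r" by (simp add: r_def)
    have "A (A (g i)) = a *\<^sub>R (a *\<^sub>R g i + r) + A r"
      by (subst Ag) (simp add: linear_add[OF A] linear_scale[OF A] Ag)
    then have "inner (A (A (g i))) (g i) = a * a"
      using g(3)[OF i r] g(3)[OF i inv[OF _ r]] i gg[OF i] by (simp add: inner_add_left)
    then show "inner (A (A (g i))) (g i) \<ge> 0" by simp
  qed
  finally show ?thesis .
qed

section \<open>Lorentzian linear algebra\<close>

lemma bilinear_on_UNIV: "bilinear_on UNIV f \<longleftrightarrow> bilinear f"
  unfolding bilinear_on_def bilinear_def linear_iff by auto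

text \<open>Gram-Schmidt for a form other than the ambient inner product: normalise a nonzero vector
  for \<open>B\<close> and recurse on its \<open>B\<close>-orthogonal complement in
  \<open>U\<close>.\<close>

lemma orthonormal_basis_of_form:
  fixes B :: "'a::euclidean_space \<Rightarrow> 'a \<Rightarrow> real"
  assumes B: "bilinear B" "\<And>x y. B x y = B y x"
    and "subspace U" "\<And>x. x \<in> U \<Longrightarrow> x \<noteq> 0 \<Longrightarrow> B x x > 0"
  shows "\<exists>E. finite E \<and> E \<subseteq> U \<and> (\<forall>x\<in>E. \<forall>y\<in>E. B x y = (if x = y then 1 else 0)) \<and>
     (\<forall>v\<in>U. v = (\<Sum>x\<in>E. B v x *\<^sub>R x))"
  using assms(3,4)
proof (induction "dim U" arbitrary: U rule: less_induct)
  case less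
  note lin = bilinear_ladd[OF B(1)] bilinear_radd[OF B(1)] bilinear_lmul[OF B(1)] bilinear_rmul[OF B(1)]
    bilinear_lzero[OF B(1)] bilinear_rzero[OF B(1)] bilinear_lsub[OF B(1)] bilinear_rsub[OF B(1)]
  show ?case
  proof (cases "U = {0}")
    case True
    then show ?thesis by (intro exI[of _ "{}"]) auto
  next
    case False
    then obtain x0 where x0: "x0 \<in> U" "x0 \<noteq> 0" using less.prems(1) subspace_0 by blast
    define x where "x = x0 /\<^sub>R sqrt (B x0 x0)"
    have x: "x \<in> U" "B x x = 1"
      using x0 less.prems(2)[OF x0] less.prems(1)
      by (auto simp: x_def lin subspace_scale field_simps)
    let ?V = "{v \<in> U. B v x = 0}"
    have V: "subspace ?V" using less.prems(1) by (auto simp: subspace_def lin)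
    have "x \<notin> ?V" using x by simp
    then have "?V \<subset> U" using x(1) by blast
    then have "dim ?V < dim U" using V less.prems(1) by (metis dim_psubset span_eq_iff)
    from less.hyps[OF this V] less.prems(2)
    obtain E where E: "finite E" "E \<subseteq> ?V" "\<forall>x\<in>E. \<forall>y\<in>E. B x y = (if x = y then 1 else 0)"
      "\<forall>v\<in>?V. v = (\<Sum>x\<in>E. B v x *\<^sub>R x)" by blast
    have xE: "x \<notin> E" using E(2) x by auto
    have xy: "B x y = 0" "B y x = 0" if "y \<in> E" for y using E(2) that B(2)[of x y] by auto
    show ?thesis
    proof (intro exI[of _ "insert x E"] conjI ballI)
      fix v assume v: "v \<in> U"
      let ?w = "v - B v x *\<^sub>R x"
      have "?w \<in> ?V" using v x less.prems(1) by (auto simp: lin subspace_diff subspace_scale)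
      then have "?w = (\<Sum>y\<in>E. B ?w y *\<^sub>R y)" using E(4) by blast
      also have "\<dots> = (\<Sum>y\<in>E. B v y *\<^sub>R y)"
        by (rule sum.cong) (auto simp: lin xy)
      finally show "v = (\<Sum>x\<in>insert x E. B v x *\<^sub>R x)"
        using E(1) xE by (simp add: algebra_simps)
    qed (use E(1-3) x xy xE in auto)
  qed
qed

text \<open>Coordinates in the basis provided by \<open>lorentzian_on\<close>. Pairing with
  \<open>f j\<close> recovers coordinate \<open>j\<close> up to sign, which yields both the diagonal
  formula and nondegeneracy.\<close>

lemma lorentzian_coords:
  fixes B :: "'a::euclidean_space \<Rightarrow> 'a \<Rightarrow> real"
  assumes "lorentzian_on UNIV B"
  shows "\<exists>a :: 'a \<Rightarrow> nat \<Rightarrow> real.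
    (\<forall>x y. B x y = - a x 0 * a y 0 + (\<Sum>i=1..<DIM('a). a x i * a y i)) \<and>
    (\<forall>x. (\<forall>i<DIM('a). a x i = 0) \<longrightarrow> x = 0) \<and> (\<forall>x. (\<forall>w. B x w = 0) \<longrightarrow> x = 0)"
proof -
  let ?n = "DIM('a)"
  let ?\<epsilon> = "\<lambda>i::nat. if i = 0 then -1 else 1 :: real"
  have B: "bilinear B" using assms by (simp add: lorentzian_on_def sym_form_on_def bilinear_on_UNIV)
  then have lin: "linear (B x)" "linear (\<lambda>x. B x y)" for x y
    by (auto simp: bilinear_def)
  obtain f :: "nat \<Rightarrow> 'a" where f: "inj_on f {..<?n}" "span (f ` {..<?n}) = UNIV"
    "\<And>i j. i < ?n \<Longrightarrow> j < ?n \<Longrightarrow> B (f i) (f j) = (if i \<noteq> j then 0 else ?\<epsilon> i)"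
    using assms by (auto simp: lorentzian_on_def)
  have "\<exists>a. x = (\<Sum>i<?n. a i *\<^sub>R f i)" for x
  proof -
    have "x \<in> range (\<lambda>u. \<Sum>v\<in>f ` {..<?n}. u v *\<^sub>R v)"
      using span_finite[of "f ` {..<?n}"] f(2) by auto
    then obtain u where "x = (\<Sum>v\<in>f ` {..<?n}. u v *\<^sub>R v)" by blast
    also have "\<dots> = (\<Sum>i<?n. u (f i) *\<^sub>R f i)" by (simp add: sum.reindex[OF f(1)])
    finally show ?thesis by (intro exI[of _ "\<lambda>i. u (f i)"])
  qed
  then obtain a where a: "\<And>x. x = (\<Sum>i<?n. a x i *\<^sub>R f i)" by metis
  have Bf: "B x (f j) = a x j * ?\<epsilon> j" if j: "j < ?n" for x j
  proof -
    have "B x (f j) = (\<Sum>i<?n. a x i * B (f i) (f j))"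
      by (subst a[of x]) (simp add: linear_sum[OF lin(2)] linear_scale[OF lin(2)])
    also have "\<dots> = (\<Sum>i<?n. if i = j then a x j * ?\<epsilon> j else 0)"
      by (intro sum.cong) (auto simp: f(3) j)
    finally show ?thesis using j by simp
  qed
  have "B x y = - a x 0 * a y 0 + (\<Sum>i=1..<?n. a x i * a y i)" for x y
  proof -
    have "B x y = (\<Sum>i<?n. a y i * B x (f i))"
      by (subst a[of y]) (simp add: linear_sum[OF lin(1)] linear_scale[OF lin(1)])
    also have "\<dots> = (\<Sum>i<?n. a x i * a y i * ?\<epsilon> i)"
      by (intro sum.cong) (auto simp: Bf)
    also have "\<dots> = - a x 0 * a y 0 + (\<Sum>i=1..<?n. a x i * a y i * ?\<epsilon> i)"
      by (simp add: lessThan_atLeast0 sum.atLeast_Suc_lessThan)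
    also have "\<dots> = - a x 0 * a y 0 + (\<Sum>i=1..<?n. a x i * a y i)"
      by (intro arg_cong2[where f = plus] sum.cong refl) auto
    finally show ?thesis .
  qed
  moreover have ax: "x = 0" if "\<forall>i<?n. a x i = 0" for x
    using a[of x] that by simp
  moreover have "x = 0" if "\<forall>w. B x w = 0" for x
  proof (rule ax, intro allI impI)
    fix j assume "j < ?n"
    from Bf[OF this, of x] that show "a x j = 0" by (simp split: if_splits)
  qed
  ultimately show ?thesis by (intro exI[of _ a] conjI allI impI)
qed

text \<open>Cauchy-Schwarz on the spatial coordinates: orthogonality gives
  \<open>(a t 0)\<^sup>2 * (a x 0)\<^sup>2 \<le> T * X\<close>, and
  \<open>T < (a t 0)\<^sup>2\<close> then forces \<open>(a x 0)\<^sup>2 < X\<close>, once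
  \<open>X = 0\<close> is excluded by \<open>x \<noteq> 0\<close>.\<close>

lemma lorentzian_pos_of_orthogonal_timelike:
  fixes B :: "'a::euclidean_space \<Rightarrow> 'a \<Rightarrow> real"
  assumes "lorentzian_on UNIV B" and t: "B t t < 0" "B t x = 0" and "x \<noteq> 0"
  shows "B x x > 0"
proof -
  let ?J = "{1..<DIM('a)}"
  obtain a where a: "\<forall>x y. B x y = - a x 0 * a y 0 + (\<Sum>i\<in>?J. a x i * a y i)"
    "\<forall>x. (\<forall>i<DIM('a). a x i = 0) \<longrightarrow> x = 0"
    using lorentzian_coords[OF assms(1)] by (elim exE conjE) (rule that)
  note a = a[rule_format]
  define X where "X = (\<Sum>i\<in>?J. (a x i)\<^sup>2)"
  define T where "T = (\<Sum>i\<in>?J. (a t i)\<^sup>2)"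
  have tt: "T < (a t 0)\<^sup>2" using t(1) by (simp add: a(1) T_def power2_eq_square)
  have tx: "a t 0 * a x 0 = (\<Sum>i\<in>?J. a t i * a x i)" using t(2) by (simp add: a(1))
  have "T \<ge> 0" "X \<ge> 0" by (auto simp: T_def X_def sum_nonneg)
  have cs: "(a t 0)\<^sup>2 * (a x 0)\<^sup>2 \<le> T * X"
    using Cauchy_Schwarz_ineq_sum[of "a t" "a x" ?J] tx
    by (simp add: T_def X_def flip: power_mult_distrib)
  have "(a t 0)\<^sup>2 > 0" using tt \<open>T \<ge> 0\<close> by linarith
  have "X \<noteq> 0"
  proof
    assume X: "X = 0"
    then have "\<forall>i\<in>?J. a x i = 0"
      by (simp add: X_def sum_nonneg_eq_0_iff)
    moreover have "a x 0 = 0"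
      using cs X \<open>(a t 0)\<^sup>2 > 0\<close> by (simp add: mult_le_0_iff)
    ultimately have "\<forall>i<DIM('a). a x i = 0"
      by (auto simp: Suc_le_eq)
    then show False using a(2) \<open>x \<noteq> 0\<close> by blast
  qed
  then have "T * X < (a t 0)\<^sup>2 * X" using tt \<open>X \<ge> 0\<close> by simp
  then have "(a t 0)\<^sup>2 * (a x 0)\<^sup>2 < (a t 0)\<^sup>2 * X" using cs by simp
  then have "(a x 0)\<^sup>2 < X" using \<open>(a t 0)\<^sup>2 > 0\<close> by simp
  then show ?thesis by (simp add: a(1) X_def power2_eq_square)
qed

section \<open>Curvature in a null frame\<close>

text \<open>\<open>expand\<close> says at once that \<open>e\<close>, \<open>h\<close> and
  \<open>E\<close> span and that \<open>B\<close> is nondegenerate. The null vectors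
  \<open>e\<close> and \<open>h\<close> are dual to each other, so the coefficient of either is the
  pairing with the other.\<close>

locale null_frame =
  fixes br :: "'a::euclidean_space \<Rightarrow> 'a \<Rightarrow> 'a" and B :: "'a \<Rightarrow> 'a \<Rightarrow> real"
    and e h :: 'a and E :: "'a set"
  assumes br_bilinear: "bilinear br" and br_skew: "br x y = - br y x"
    and B_bilinear: "bilinear B" and B_sym: "B x y = B y x"
    and B_ee: "B e e = 0" and B_hh: "B h h = 0" and B_eh: "B e h = 1"
    and E_finite: "finite E"
    and E_orthonormal: "x \<in> E \<Longrightarrow> y \<in> E \<Longrightarrow> B x y = (if x = y then 1 else 0)"
    and E_e: "x \<in> E \<Longrightarrow> B x e = 0" and E_h: "x \<in> E \<Longrightarrow> B x h = 0"
    and expand: "v = B v h *\<^sub>R e + B v e *\<^sub>R h + (\<Sum>x\<in>E. B v x *\<^sub>R x)"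
begin

lemmas B_lin = bilinear_ladd[OF B_bilinear] bilinear_radd[OF B_bilinear]
  bilinear_lmul[OF B_bilinear] bilinear_rmul[OF B_bilinear]
  bilinear_lneg[OF B_bilinear] bilinear_rneg[OF B_bilinear]
  bilinear_lsub[OF B_bilinear] bilinear_rsub[OF B_bilinear]
  bilinear_lzero[OF B_bilinear] bilinear_rzero[OF B_bilinear]

lemmas br_lin = bilinear_ladd[OF br_bilinear] bilinear_radd[OF br_bilinear]
  bilinear_lmul[OF br_bilinear] bilinear_rmul[OF br_bilinear]
  bilinear_lneg[OF br_bilinear] bilinear_rneg[OF br_bilinear]
  bilinear_lsub[OF br_bilinear] bilinear_rsub[OF br_bilinear]
  bilinear_lzero[OF br_bilinear] bilinear_rzero[OF br_bilinear]

lemma B_linear: "linear (B x)" "linear (\<lambda>x. B x y)"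
  using B_bilinear by (auto simp: bilinear_def)

lemma br_linear: "linear (br x)" "linear (\<lambda>x. br x y)"
  using br_bilinear by (auto simp: bilinear_def)

lemma B_eqI: "(\<And>w. B x w = B y w) \<Longrightarrow> x = y"
  by (subst expand[of x], subst expand[of y]) simp

text \<open>Contraction of a bilinear expression with the inverse of \<open>B\<close>: the frame dual to
  \<open>e, h, E\<close> is \<open>h, e, E\<close>.\<close>

definition contr :: "('a \<Rightarrow> 'a \<Rightarrow> 'b::ab_group_add) \<Rightarrow> 'b" where
  "contr f = f e h + f h e + (\<Sum>x\<in>E. f x x)"

lemma expand_contr: "v = contr (\<lambda>x y. B v y *\<^sub>R x)"
  using expand[of v] by (simp add: contr_def)

lemma contr_cmult: "contr (\<lambda>x y. c * f x y) = c * contr f" for c :: real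
  by (simp add: contr_def sum_distrib_left algebra_simps)

lemma contr_swap: "contr (\<lambda>x y. contr (f x y)) = contr (\<lambda>x' y'. contr (\<lambda>x y. f x y x' y'))"
proof -
  have "(\<Sum>x\<in>E. \<Sum>x'\<in>E. f x x x' x') = (\<Sum>x'\<in>E. \<Sum>x\<in>E. f x x x' x')"
    by (rule sum.swap)
  then show ?thesis by (simp add: contr_def sum.distrib algebra_simps)
qed

lemma contr_flip: "contr (\<lambda>x y. f y x) = contr f"
  by (simp add: contr_def)

lemma linear_contr:
  assumes "linear f"
  shows "f (contr g) = contr (\<lambda>x y. f (g x y))"
  by (simp add: contr_def linear_add[OF assms] linear_sum[OF assms])

text \<open>The Riesz representative of a functional, written in the frame. It is the witness for
  the descriptions that define \<open>LC\<close> and \<open>ricci_op\<close>.\<close>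

lemma B_riesz:
  assumes "linear g"
  shows "B (contr (\<lambda>x y. g y *\<^sub>R x)) v = g v"
proof -
  have "B (contr (\<lambda>x y. g y *\<^sub>R x)) v = contr (\<lambda>x y. B v x * g y)"
    by (simp add: linear_contr[OF B_linear(2)] B_lin B_sym[of v] mult.commute)
  also have "\<dots> = contr (\<lambda>x y. B v y * g x)"
    by (rule contr_flip)
  also have "\<dots> = g (contr (\<lambda>x y. B v y *\<^sub>R x))"
    by (simp add: linear_contr[OF assms] linear_scale[OF assms])
  finally show ?thesis using expand_contr[of v] by simp
qed

lemma trace_contr:
  assumes A: "linear A"
  shows "trace_on UNIV A = contr (\<lambda>x y. B (A x) y)"
proof -
  \<comment> \<open>\<open>d\<close> sends each frame vector to its dual. As \<open>e\<close>,
    \<open>h\<close> and \<open>E\<close> are disjoint, the three parts of \<open>contr\<close>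
    become one indexed sum.\<close>
  define d where "d x = (if x = e then h else if x = h then e else x)" for x
  have ne: "e \<noteq> h" "e \<notin> E" "h \<notin> E"
    using B_ee B_eh B_hh E_e E_h B_sym[of h e] by auto
  have dE: "d x = x" if "x \<in> E" for x using that ne by (auto simp: d_def)
  have d: "d e = h" "d h = e" using ne by (auto simp: d_def)
  have "trace_on UNIV A = (\<Sum>x\<in>insert e (insert h E). B (A x) (d x))"
  proof (rule trace_on_UNIV_coords[OF A])
    show "v = (\<Sum>x\<in>insert e (insert h E). B v (d x) *\<^sub>R x)" for v
      using expand[of v] ne E_finite by (simp add: d dE add.assoc)
  qed (rule B_linear)
  then show ?thesis
    using ne E_finite by (simp add: contr_def d dE add.assoc)
qed

lemma trace_comp:
  fixes A C :: "'a \<Rightarrow> 'a"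
  assumes A: "linear A" and C: "linear C"
  shows "trace_on UNIV (\<lambda>w. A (C w)) = contr (\<lambda>x y. contr (\<lambda>x' y'. B (C x) y' * B (A x') y))"
proof -
  have "B (A (C x)) y = contr (\<lambda>x' y'. B (C x) y' * B (A x') y)" for x y
    by (subst expand_contr[of "C x"])
      (simp add: linear_contr[OF A] linear_contr[OF B_linear(2)] linear_scale[OF A] B_lin)
  then show ?thesis
    using trace_contr[OF linear_compose[OF C A]] by (simp add: o_def)
qed

lemma trace_comp_commute:
  fixes A C :: "'a \<Rightarrow> 'a"
  assumes "linear A" "linear C"
  shows "trace_on UNIV (\<lambda>w. A (C w)) = trace_on UNIV (\<lambda>w. C (A w))"
proof -
  have "trace_on UNIV (\<lambda>w. A (C w)) = contr (\<lambda>x y. contr (\<lambda>x' y'. B (C x) y' * B (A x') y))"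
    by (rule trace_comp[OF assms])
  also have "\<dots> = contr (\<lambda>x' y'. contr (\<lambda>x y. B (A x') y * B (C x) y'))"
    by (subst contr_swap) (simp only: mult.commute)
  also have "\<dots> = trace_on UNIV (\<lambda>w. C (A w))"
    by (rule trace_comp[OF assms(2,1), symmetric])
  finally show ?thesis .
qed

section \<open>The Levi-Civita connection\<close>

abbreviation "L \<equiv> LC UNIV br B"

lemma LC_unique:
  assumes "\<And>w. 2 * B x w = B (br u v) w + B (br w u) v + B (br w v) u"
  shows "L u v = x"
proof -
  have "x' = x" if "\<forall>w. 2 * B x' w = B (br u v) w + B (br w u) v + B (br w v) u" for x'
    by (rule B_eqI) (use assms that in \<open>metis mult_cancel_left zero_neq_numeral\<close>)
  then show ?thesis unfolding LC_def using assms by (intro the_equality) auto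
qed

lemma LC_B: "2 * B (L u v) w = B (br u v) w + B (br w u) v + B (br w v) u"
proof -
  define g where "g w = 1/2 * (B (br u v) w + B (br w u) v + B (br w v) u)" for w
  have "linear g"
    by (rule linearI) (simp_all add: g_def B_lin br_lin algebra_simps)
  then have R: "B (contr (\<lambda>x y. g y *\<^sub>R x)) w = g w" for w by (rule B_riesz)
  have "L u v = contr (\<lambda>x y. g y *\<^sub>R x)"
    by (rule LC_unique) (simp only: R, simp add: g_def)
  then have "B (L u v) w = g w" by (simp only: R)
  then show ?thesis by (simp add: g_def)
qed

lemma LC_B_half: "B (L u v) w = (B (br u v) w + B (br w u) v + B (br w v) u) / 2"
  using LC_B[of u v w] by simp

lemma LC_linear: "linear (L u)" "linear (\<lambda>u. L u v)"
  by (rule linearI; rule B_eqI; simp add: LC_B_half B_lin br_lin field_simps)+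

lemmas LC_lin = linear_add[OF LC_linear(1)] linear_scale[OF LC_linear(1)]
  linear_diff[OF LC_linear(1)] linear_neg[OF LC_linear(1)]
  linear_add[OF LC_linear(2)] linear_scale[OF LC_linear(2)]
  linear_diff[OF LC_linear(2)] linear_neg[OF LC_linear(2)]

lemma LC_skew: "B (L u v) w = - B (L u w) v"
  using br_skew[of u v] br_skew[of u w] br_skew[of w v]
  by (simp add: LC_B_half B_lin field_simps)

lemma LC_torsion_free: "L w u = L u w - br u w"
  by (rule B_eqI)
    (use br_skew[of w u] in \<open>simp add: LC_B_half B_lin field_simps\<close>)

lemma trace_LC: "trace_on UNIV (L u) = 0"
  unfolding trace_contr[OF LC_linear(1)] contr_def
  using LC_skew[of u e h] LC_skew[of u x x for x] by simp

section \<open>Curvature and the Ricci form\<close>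

abbreviation "curvature \<equiv> curv UNIV br B"

lemma curv_linear: "linear (\<lambda>w. curvature u w v)" "linear (\<lambda>v. curvature u w v)"
  by (rule linearI; simp add: curv_def LC_lin br_lin algebra_simps)+

abbreviation "ric u v \<equiv> trace_on UNIV (\<lambda>w. curvature u w v)"

lemma B_ricci_op: "B (ricci_op UNIV br B u) v = ric u v"
proof -
  have lin: "linear (ric u)"
    by (rule linearI)
      (simp_all add: trace_on_def linear_add[OF curv_linear(2)] linear_scale[OF curv_linear(2)]
        inner_add_left sum.distrib sum_distrib_left)
  have "\<exists>!x. x \<in> UNIV \<and> (\<forall>v\<in>UNIV. B x v = ric u v)"
    by (rule ex1I[of _ "contr (\<lambda>x y. ric u y *\<^sub>R x)"])
      (use B_riesz[OF lin] in \<open>auto intro: B_eqI\<close>)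
  from theI'[OF this] show ?thesis unfolding ricci_op_def by blast
qed

text \<open>The curvature trace also contains \<open>tr (w \<mapsto> L w (L u v))\<close>, which is zero because
  \<open>L (L u v)\<close> is skew and \<open>br (L u v)\<close> is traceless.\<close>

lemma ric_contr:
  assumes unimod: "\<And>u. trace_on UNIV (br u) = 0"
  shows "ric u v = - contr (\<lambda>x y. contr (\<lambda>x' y'. B (L x v) y' * B (L x' u) y))"
proof -
  have R: "linear (\<lambda>w. L w u)" "linear (\<lambda>w. L w v)" by (rule LC_linear)+
  have "trace_on UNIV (\<lambda>w. L w (L u v)) = trace_on UNIV (L (L u v)) - trace_on UNIV (br (L u v))"
    by (subst LC_torsion_free) (simp add: trace_on_def inner_diff_left sum_subtractf)
  then have 0: "trace_on UNIV (\<lambda>w. L w (L u v)) = 0" by (simp add: trace_LC unimod)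
  have "ric u v = trace_on UNIV (\<lambda>w. L (br u w) v) - trace_on UNIV (\<lambda>w. L u (L w v))
      + trace_on UNIV (\<lambda>w. L w (L u v))"
    by (simp add: trace_on_def curv_def inner_add_left inner_diff_left sum.distrib sum_subtractf)
  \<comment> \<open>Cyclicity of the trace brings \<open>br u\<close> to the front; writing it as a
    difference of connection terms then cancels \<open>L u (L w v)\<close>.\<close>
  also have "trace_on UNIV (\<lambda>w. L (br u w) v) = trace_on UNIV (\<lambda>w. br u (L w v))"
    by (rule trace_comp_commute[OF R(2) br_linear(1)])
  also have "trace_on UNIV (\<lambda>w. br u (L w v)) - trace_on UNIV (\<lambda>w. L u (L w v))
      = - trace_on UNIV (\<lambda>w. L (L w v) u)"
  proof -
    have "br u x = L u x - L x u" for x using LC_torsion_free[of x u] by simp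
    then show ?thesis by (simp add: trace_on_def inner_diff_left sum_subtractf)
  qed
  finally show ?thesis using trace_comp[OF R] 0 by simp
qed

text \<open>By the Koszul formula this is \<open>2 * B (L x y) u\<close>, twice a second fundamental
  form with normal \<open>u\<close>; its skew part in \<open>x\<close> and \<open>y\<close> is
  \<open>B u (br x y)\<close>.\<close>

definition sff :: "'a \<Rightarrow> 'a \<Rightarrow> 'a \<Rightarrow> real" where
  "sff u x y = B (br u x) y + B (br u y) x + B u (br x y)"

lemma LC_sff: "B (L x u) y = - sff u x y / 2"
  using br_skew[of x u] br_skew[of y x] br_skew[of y u]
  by (simp add: LC_B_half sff_def B_lin B_sym[of u])

lemma ric_sff:
  assumes "\<And>u. trace_on UNIV (br u) = 0"
  shows "4 * ric u v = - contr (\<lambda>x y. contr (\<lambda>x' y'. sff v x y' * sff u x' y))"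
proof -
  have "contr (\<lambda>x y. contr (\<lambda>x' y'. B (L x v) y' * B (L x' u) y))
     = contr (\<lambda>x y. contr (\<lambda>x' y'. (1/4) * (sff v x y' * sff u x' y)))"
    by (simp add: LC_sff)
  then show ?thesis unfolding ric_contr[OF assms] contr_cmult by simp
qed

end

section \<open>Transport along isometric isomorphisms\<close>

lemma isometric_iso_onD:
  assumes "isometric_iso_on UNIV br B S br' B' \<phi>"
  shows "linear \<phi>" "bij_betw \<phi> UNIV S" "S = range \<phi>" "subspace S" "inj \<phi>"
    "br' (\<phi> x) (\<phi> y) = \<phi> (br x y)" "B' (\<phi> x) (\<phi> y) = B x y"
proof -
  show lin: "linear \<phi>" using assms by (intro linearI) (auto simp: isometric_iso_on_def)
  show "bij_betw \<phi> UNIV S" using assms by (simp add: isometric_iso_on_def)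
  then show S: "S = range \<phi>" and "inj \<phi>" by (auto simp: bij_betw_def)
  show "subspace S" unfolding S by (rule linear_subspace_image[OF lin subspace_UNIV])
qed (use assms in \<open>simp_all add: isometric_iso_on_def\<close>)

lemma lie_algebra_transport:
  assumes L: "lie_algebra_on UNIV br" and iso: "isometric_iso_on UNIV br B S br' B' \<phi>"
  shows "lie_algebra_on S br'"
proof -
  note D = isometric_iso_onD[OF iso]
  note D' = D(6) linear_add[OF D(1), symmetric] linear_scale[OF D(1), symmetric]
    linear_neg[OF D(1), symmetric]
  have br: "bilinear br" "br x y = - br y x"
    "br x (br y z) + br y (br z x) + br z (br x y) = 0" for x y z
    using L unfolding lie_algebra_on_def bilinear_on_UNIV by blast+
  note lin = bilinear_ladd[OF br(1)] bilinear_radd[OF br(1)] bilinear_lmul[OF br(1)] bilinear_rmul[OF br(1)]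
  have "bilinear_on S br'"
    unfolding bilinear_on_def D(3) by (simp add: D' lin)
  moreover have "br' x y = - br' y x" if xy: "x \<in> S" "y \<in> S" for x y
  proof -
    obtain x' y' where "x = \<phi> x'" "y = \<phi> y'" using xy unfolding D(3) by blast
    then show ?thesis using br(2)[of x' y'] by (simp add: D')
  qed
  moreover have "br' x (br' y z) + br' y (br' z x) + br' z (br' x y) = 0"
    if "x \<in> S" "y \<in> S" "z \<in> S" for x y z
    using that br(3) unfolding D(3) by (auto simp: D' linear_0[OF D(1)])
  moreover have "br' x y \<in> S" if "x \<in> S" "y \<in> S" for x y
    using that unfolding D(3) by (auto simp: D')
  ultimately show ?thesis using D(4) unfolding lie_algebra_on_def by blast
qed

lemma lorentzian_transport:
  assumes L: "lorentzian_on UNIV B" and iso: "isometric_iso_on UNIV br B S br' B' \<phi>"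
  shows "lorentzian_on S B'"
proof -
  note D = isometric_iso_onD[OF iso]
  note D' = D(7) linear_add[OF D(1), symmetric] linear_scale[OF D(1), symmetric]
  let ?n = "dim (UNIV :: 'a set)"
  have B: "bilinear B" "B x y = B y x" for x y
    using L by (auto simp: lorentzian_on_def sym_form_on_def bilinear_on_UNIV)
  note lin = bilinear_ladd[OF B(1)] bilinear_radd[OF B(1)] bilinear_lmul[OF B(1)] bilinear_rmul[OF B(1)]
  have "sym_form_on S B'"
    unfolding sym_form_on_def bilinear_on_def D(3) using B(2) by (simp add: D' lin)
  moreover obtain f :: "nat \<Rightarrow> 'a" where f: "inj_on f {..<?n}" "independent (f ` {..<?n})"
    "span (f ` {..<?n}) = UNIV"
    "\<And>i j. i < ?n \<Longrightarrow> j < ?n \<Longrightarrow> B (f i) (f j) = (if i \<noteq> j then 0 else if i = 0 then -1 else 1)"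
    using L unfolding lorentzian_on_def by blast
  have "dim S = ?n"
    unfolding D(3) using D(5) by (intro dim_image_eq[OF D(1)]) (auto intro: inj_on_subset)
  moreover have "inj_on (\<phi> \<circ> f) {..<?n}"
    using f(1) D(5) by (auto intro: comp_inj_on inj_on_subset)
  moreover have "independent ((\<phi> \<circ> f) ` {..<?n})"
    unfolding image_comp[symmetric] using f(2) D(1,5)
    by (intro linear_independent_injective_image) (auto intro: inj_on_subset)
  moreover have "span ((\<phi> \<circ> f) ` {..<?n}) = S"
    unfolding image_comp[symmetric] linear_span_image[OF D(1)] f(3) D(3) ..
  ultimately show ?thesis
    unfolding lorentzian_on_def using f(4)
    by (intro conjI exI[of _ "\<phi> \<circ> f"]) (auto simp: D(7) D(3))
qed

context null_frame
begin

text \<open>Uniqueness of the vector described on \<open>S\<close> is pulled back along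
  \<open>\<phi>\<close> to \<open>UNIV\<close>, where the frame gives
  \<open>LC_unique\<close>.\<close>

lemma LC_transport:
  assumes iso: "isometric_iso_on UNIV br B S br' B' \<phi>"
  shows "LC S br' B' (\<phi> u) (\<phi> v) = \<phi> (L u v)"
proof -
  note D = isometric_iso_onD[OF iso]
  show ?thesis
    unfolding LC_def[of S]
  proof (rule the_equality)
    show "\<phi> (L u v) \<in> S \<and> (\<forall>w\<in>S. 2 * B' (\<phi> (L u v)) w
        = B' (br' (\<phi> u) (\<phi> v)) w + B' (br' w (\<phi> u)) (\<phi> v) + B' (br' w (\<phi> v)) (\<phi> u))"
      unfolding D(3) by (simp add: D(6,7) LC_B)
  next
    fix x assume x: "x \<in> S \<and> (\<forall>w\<in>S. 2 * B' x w
        = B' (br' (\<phi> u) (\<phi> v)) w + B' (br' w (\<phi> u)) (\<phi> v) + B' (br' w (\<phi> v)) (\<phi> u))"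
    then obtain x' where x': "x = \<phi> x'" unfolding D(3) by blast
    have "2 * B x' w = B (br u v) w + B (br w u) v + B (br w v) u" for w
      using x unfolding x' D(3) by (auto simp: D(6,7))
    then show "x = \<phi> (L u v)" using LC_unique x' by blast
  qed
qed

lemma ricci_op_transport:
  assumes iso: "isometric_iso_on UNIV br B S br' B' \<phi>"
  shows "ricci_op S br' B' (\<phi> u) = \<phi> (ricci_op UNIV br B u)"
proof -
  note D = isometric_iso_onD[OF iso]
  have ric: "trace_on S (\<lambda>w. curv S br' B' (\<phi> u) w (\<phi> v)) = ric u v" for v
    by (rule trace_on_transport[OF curv_linear(1) D(1,2)])
      (simp add: curv_def D(6) LC_transport[OF iso] linear_diff[OF D(1)])
  show ?thesis
    unfolding ricci_op_def[of S]
  proof (rule the_equality)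
    show "\<phi> (ricci_op UNIV br B u) \<in> S \<and> (\<forall>v\<in>S. B' (\<phi> (ricci_op UNIV br B u)) v
        = trace_on S (\<lambda>w. curv S br' B' (\<phi> u) w v))"
      using ric unfolding D(3) by (simp add: D(7) B_ricci_op)
  next
    fix x assume x: "x \<in> S \<and> (\<forall>v\<in>S. B' x v = trace_on S (\<lambda>w. curv S br' B' (\<phi> u) w v))"
    then obtain x' where x': "x = \<phi> x'" unfolding D(3) by blast
    have "B x' v = B (ricci_op UNIV br B u) v" for v
      unfolding B_ricci_op using x ric[of v] unfolding x' by (metis D(3,7) rangeI)
    then show "x = \<phi> (ricci_op UNIV br B u)" using B_eqI x' by blast
  qed
qed

text \<open>Used in both directions: to make the constructed extension admissible, and as the whole
  converse of the theorem.\<close>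

lemma einstein_transport:
  assumes iso: "isometric_iso_on UNIV br B S br' B' \<phi>"
  shows "einstein_on S br' B' \<longleftrightarrow> einstein_on UNIV br B"
proof -
  note D = isometric_iso_onD[OF iso]
  show ?thesis
    unfolding einstein_on_def D(3)
    by (simp add: ricci_op_transport[OF iso, unfolded D(3)] inj_eq[OF D(5)]
        flip: linear_scale[OF D(1)])
qed

end

section \<open>Einstein algebras with a null central vector\<close>

locale einstein_null_frame = null_frame +
  fixes c :: real
  assumes unimodular: "trace_on UNIV (br u) = 0"
    and central: "br e x = 0"
    and einstein: "ricci_op UNIV br B u = c *\<^sub>R u"
begin

lemma central': "br x e = 0"
  using br_skew[of x e] central[of x] by simp

lemma B_br_skew: "B (br x y) z = - B (br y x) z"
  using br_skew[of x y] by (simp add: B_lin)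

lemma ric_eq: "ric u v = c * B u v"
  using B_ricci_op[of u v] einstein[of u] by (simp add: B_lin)

lemma contr_sff: "contr (\<lambda>x y. contr (\<lambda>x' y'. sff v x y' * sff u x' y)) = - 4 * c * B u v"
  using ric_sff[OF unimodular, of u v] by (simp add: ric_eq)

lemma sff_e: "sff e x y = B (br x y) e"
  by (simp add: sff_def central B_lin B_sym)

text \<open>\<open>B e e = 0\<close> makes \<open>ric e e\<close> vanish whatever \<open>c\<close>
  is, and skewness of the bracket turns its contraction into minus a sum of squares.\<close>

lemma br_E_E_e:
  assumes "u \<in> E" "v \<in> E"
  shows "B (br u v) e = 0"
proof -
  have "contr (\<lambda>x y. contr (\<lambda>x' y'. sff e x y' * sff e x' y))
      = (\<Sum>i\<in>E. \<Sum>j\<in>E. B (br i j) e * B (br j i) e)"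
    \<comment> \<open>A dual pair formed by \<open>e\<close> and \<open>h\<close> always puts the
      central \<open>e\<close> into one of the two brackets, so only \<open>E\<close>
      contributes.\<close>
    by (simp add: contr_def sff_e central central' B_lin)
  also have "\<dots> = - (\<Sum>i\<in>E. \<Sum>j\<in>E. (B (br i j) e)\<^sup>2)"
    by (subst (2) B_br_skew) (simp add: power2_eq_square sum_negf)
  finally have "(\<Sum>i\<in>E. \<Sum>j\<in>E. (B (br i j) e)\<^sup>2) = 0"
    using contr_sff[of e e] by (simp add: B_ee)
  then show ?thesis
    using assms E_finite by (simp add: sum_nonneg_eq_0_iff sum_nonneg)
qed

lemma br_h_h: "br h h = 0"
proof -
  have "br h h + br h h = 0"
    using br_skew[of h h] eq_neg_iff_add_eq_0 by blast
  then show ?thesis by (simp flip: scaleR_2)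
qed

text \<open>Since \<open>B e h = 1\<close>, the value \<open>ric e h\<close> is \<open>c\<close>. By
  centrality and \<open>br_E_E_e\<close> only two sums over \<open>E\<close> survive in its
  contraction, and they cancel by skewness of the bracket.\<close>

lemma einstein_constant: "c = 0"
proof -
  have sff_h: "sff h e i = B (br h i) e" "sff h i e = B (br h i) e" for i
    by (simp_all add: sff_def central central' B_lin)
  have "contr (\<lambda>x y. contr (\<lambda>x' y'. sff h x y' * sff e x' y))
      = (\<Sum>i\<in>E. sff h e i * B (br i h) e) + (\<Sum>i\<in>E. sff h i e * B (br h i) e)"
    by (simp add: contr_def sff_e central central' B_lin br_E_E_e br_h_h)
  then show ?thesis
    using contr_sff[of h e] B_br_skew[of _ h e]
    by (simp add: sff_h B_eh sum_negf)
qed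

text \<open>This is \<open>ric u u = 0\<close>, with \<open>c = 0\<close>. The pairs
  \<open>(e, h)\<close> and \<open>(h, e)\<close> each give the same square; the terms mixing them
  with \<open>E\<close> contain some \<open>B (br u i) e\<close> with
  \<open>i \<in> E\<close>.\<close>

lemma contr_sff_E:
  assumes "u \<in> E"
  shows "2 * (B (br u h) e)\<^sup>2 + (\<Sum>i\<in>E. \<Sum>j\<in>E. sff u i j * sff u j i) = 0"
proof -
  have "sff u e y = B (br u y) e" "sff u y e = B (br u y) e" for y
    by (simp_all add: sff_def central central' B_lin)
  then have "contr (\<lambda>x y. contr (\<lambda>x' y'. sff u x y' * sff u x' y))
      = 2 * (B (br u h) e)\<^sup>2 + (\<Sum>i\<in>E. \<Sum>j\<in>E. sff u i j * sff u j i)"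
    using assms by (simp add: contr_def central' B_lin br_E_E_e power2_eq_square)
  then show ?thesis using contr_sff[of u u] einstein_constant by simp
qed

text \<open>Since \<open>br u e = 0\<close>, the square appears once here and twice in
  \<open>contr_sff_E\<close>; hence twice this trace matches that equation.\<close>

lemma trace_ad_square_E:
  assumes "u \<in> E"
  shows "trace_on UNIV (\<lambda>w. br u (br u w))
    = (B (br u h) e)\<^sup>2 + (\<Sum>i\<in>E. \<Sum>j\<in>E. B (br u i) j * B (br u j) i)"
  unfolding trace_comp[OF br_linear(1) br_linear(1)]
  using assms by (simp add: contr_def central' B_lin br_E_E_e power2_eq_square)

text \<open>\<open>sff u i j\<close> and \<open>sff u j i\<close> share their symmetric part and
  have opposite skew parts, so the product is a difference of squares. Once \<open>u\<close> is
  summed too, the three sums of squares with permuted indices agree, and one is left.\<close>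

lemma sum_sff_E:
  "(\<Sum>u\<in>E. \<Sum>i\<in>E. \<Sum>j\<in>E. sff u i j * sff u j i)
    = (\<Sum>u\<in>E. \<Sum>i\<in>E. \<Sum>j\<in>E. (B (br u i) j)\<^sup>2)
      + 2 * (\<Sum>u\<in>E. \<Sum>i\<in>E. \<Sum>j\<in>E. B (br u i) j * B (br u j) i)"
proof -
  define C where "C u i j = B (br u i) j" for u i j
  have sff: "sff u i j * sff u j i
      = (C u i j)\<^sup>2 + (C u j i)\<^sup>2 - (C i j u)\<^sup>2 + 2 * (C u i j * C u j i)" for u i j
    using B_br_skew[of j i u]
    by (simp add: sff_def C_def B_sym[of u] power2_eq_square algebra_simps)
  have 1: "(\<Sum>u\<in>E. \<Sum>i\<in>E. \<Sum>j\<in>E. (C u j i)\<^sup>2) = (\<Sum>u\<in>E. \<Sum>i\<in>E. \<Sum>j\<in>E. (C u i j)\<^sup>2)"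
    by (rule sum.cong[OF refl sum.swap])
  have "(\<Sum>u\<in>E. \<Sum>i\<in>E. \<Sum>j\<in>E. (C i j u)\<^sup>2) = (\<Sum>i\<in>E. \<Sum>u\<in>E. \<Sum>j\<in>E. (C i j u)\<^sup>2)"
    by (rule sum.swap)
  also have "\<dots> = (\<Sum>i\<in>E. \<Sum>j\<in>E. \<Sum>u\<in>E. (C i j u)\<^sup>2)"
    by (rule sum.cong[OF refl sum.swap])
  finally have 2: "(\<Sum>u\<in>E. \<Sum>i\<in>E. \<Sum>j\<in>E. (C i j u)\<^sup>2) = (\<Sum>u\<in>E. \<Sum>i\<in>E. \<Sum>j\<in>E. (C u i j)\<^sup>2)" .
  show ?thesis
    unfolding sff C_def[symmetric]
    by (simp add: sum.distrib sum_subtractf sum_distrib_left 1 2)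
qed

lemma br_E_vanishing:
  assumes pos: "\<And>u. trace_on UNIV (\<lambda>w. br u (br u w)) \<ge> 0"
  shows "\<And>u i j. u \<in> E \<Longrightarrow> i \<in> E \<Longrightarrow> j \<in> E \<Longrightarrow> B (br u i) j = 0"
    and "\<And>u. u \<in> E \<Longrightarrow> B (br u h) e = 0"
proof -
  let ?W = "\<Sum>u\<in>E. (B (br u h) e)\<^sup>2"
  let ?P = "\<Sum>u\<in>E. \<Sum>i\<in>E. \<Sum>j\<in>E. (B (br u i) j)\<^sup>2"
  let ?Q = "\<Sum>u\<in>E. \<Sum>i\<in>E. \<Sum>j\<in>E. B (br u i) j * B (br u j) i"
  have "(\<Sum>u\<in>E. 2 * (B (br u h) e)\<^sup>2 + (\<Sum>i\<in>E. \<Sum>j\<in>E. sff u i j * sff u j i)) = 0"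
    using contr_sff_E by simp
  then have "2 * ?W + (?P + 2 * ?Q) = 0"
    by (simp add: sum.distrib sum_sff_E flip: sum_distrib_left)
  moreover have "(\<Sum>u\<in>E. (B (br u h) e)\<^sup>2 + (\<Sum>i\<in>E. \<Sum>j\<in>E. B (br u i) j * B (br u j) i)) \<ge> 0"
    by (rule sum_nonneg) (use pos in \<open>simp flip: trace_ad_square_E\<close>)
  then have "?W + ?Q \<ge> 0" by (simp add: sum.distrib)
  moreover have "?P \<ge> 0" by (intro sum_nonneg) simp
  \<comment> \<open>The equation reads \<open>?P + 2 * (?W + ?Q) = 0\<close> with both parts
    nonnegative. Afterwards \<open>?P = 0\<close> kills \<open>?Q\<close> termwise, and so
    \<open>?W\<close>.\<close>
  ultimately have P: "?P = 0" and WQ: "?W + ?Q = 0" by linarith+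
  show br0: "B (br u i) j = 0" if "u \<in> E" "i \<in> E" "j \<in> E" for u i j
    using P that E_finite by (simp add: sum_nonneg_eq_0_iff sum_nonneg)
  have "?Q = 0" by (simp add: br0)
  then have "?W = 0" using WQ by simp
  then show "B (br u h) e = 0" if "u \<in> E" for u
    using that E_finite by (simp add: sum_nonneg_eq_0_iff)
qed

lemma ricci_flat: "ricci_flat_on UNIV br B"
  by (simp add: ricci_flat_on_def einstein einstein_constant)

section \<open>The double extension data read off from the frame\<close>

definition U where "U = {x. B x e = 0 \<and> B x h = 0}"

lemma U_expand: "u \<in> U \<Longrightarrow> (\<Sum>i\<in>E. B u i *\<^sub>R i) = u"
  using expand[of u] by (simp add: U_def)

lemma subspace_U: "subspace U"
  by (auto simp: U_def subspace_def B_lin)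

lemma E_subset_U: "E \<subseteq> U"
  by (auto simp: U_def E_e E_h)

lemma linear_eq_on_U:
  assumes "linear f" "linear g" "\<And>i. i \<in> E \<Longrightarrow> f i = g i" "u \<in> U"
  shows "f u = g u"
proof -
  have "f (\<Sum>i\<in>E. B u i *\<^sub>R i) = g (\<Sum>i\<in>E. B u i *\<^sub>R i)"
    using assms(3)
    by (simp add: linear_sum[OF assms(1)] linear_sum[OF assms(2)] linear_scale[OF assms(1)]
        linear_scale[OF assms(2)])
  then show ?thesis by (simp add: U_expand[OF assms(4)])
qed

lemma euclidean_form_U: "euclidean_form_on U B"
  unfolding euclidean_form_on_def sym_form_on_def
proof (intro conjI ballI impI)
  show "bilinear_on U B"
    using B_bilinear bilinear_on_UNIV[of B] by (auto simp: bilinear_on_def)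
  fix x assume x: "x \<in> U" "x \<noteq> 0"
  have "B x x = (\<Sum>i\<in>E. (B x i)\<^sup>2)"
    by (subst (2) U_expand[OF x(1), symmetric])
      (simp add: linear_sum[OF B_linear(1)] B_lin power2_eq_square)
  moreover have "\<exists>i\<in>E. B x i \<noteq> 0"
  proof (rule ccontr)
    assume "\<not> (\<exists>i\<in>E. B x i \<noteq> 0)"
    then show False using U_expand[OF x(1)] x(2) by simp
  qed
  ultimately show "B x x > 0"
    using E_finite by (metis sum_pos2 zero_le_power2 zero_less_power2)
qed (rule B_sym)

definition P where "P x = x - B x h *\<^sub>R e - B x e *\<^sub>R h"

lemma P_linear: "linear P"
  by (rule linearI) (simp_all add: P_def B_lin algebra_simps)

lemma P_in_U: "P x \<in> U"
  by (simp add: U_def P_def B_lin B_ee B_hh B_eh B_sym[of h e])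

text \<open>With \<open>h\<close> in the role of \<open>ebar\<close>, the
  \<open>e\<close>-coefficients of \<open>br u v\<close> and \<open>br h v\<close> are their
  pairings with \<open>h\<close>. \<open>K u\<close> and \<open>b\<close> are the vectors of
  \<open>U\<close> representing these as functionals of \<open>v\<close>.\<close>

definition K where "K u = (\<Sum>i\<in>E. B (br u i) h *\<^sub>R i)"
definition D where "D u = P (br h u)"
definition b where "b = (\<Sum>i\<in>E. B (br h i) h *\<^sub>R i)"
definition \<phi> where "\<phi> x = (B x h, P x, B x e)"

lemma sum_E_in_U: "(\<Sum>i\<in>E. f i *\<^sub>R i) \<in> U"
  using E_subset_U by (auto intro!: subspace_sum subspace_U subspace_scale)

lemma B_sum_E:
  assumes "linear f" "u \<in> U"
  shows "B (\<Sum>i\<in>E. f i *\<^sub>R i) u = f u"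
proof -
  have "B (\<Sum>i\<in>E. f i *\<^sub>R i) u = f (\<Sum>i\<in>E. B u i *\<^sub>R i)"
    by (simp add: linear_sum[OF B_linear(2)] B_lin linear_sum[OF assms(1)]
        linear_scale[OF assms(1)] B_sym[of u] mult.commute)
  then show ?thesis by (simp add: U_expand[OF assms(2)])
qed

lemma B_K: "v \<in> U \<Longrightarrow> B (K u) v = B (br u v) h"
  unfolding K_def by (rule B_sum_E) (auto intro!: linearI simp: B_lin br_lin)

lemma B_b: "v \<in> U \<Longrightarrow> B b v = B (br h v) h"
  unfolding b_def by (rule B_sum_E) (auto intro!: linearI simp: B_lin br_lin)

lemma endo_K: "endo_on U K"
  unfolding endo_on_def using sum_E_in_U
  by (auto simp: K_def br_lin B_lin algebra_simps sum.distrib scaleR_sum_right)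

lemma endo_D: "endo_on U D"
  unfolding endo_on_def using P_in_U
  by (auto simp: D_def br_lin linear_add[OF P_linear] linear_scale[OF P_linear])

lemma K_skew: "u \<in> U \<Longrightarrow> v \<in> U \<Longrightarrow> B (K u) v = - B u (K v)"
  using B_br_skew[of u v h] by (simp add: B_K B_sym[of u])

context
  assumes pos: "\<And>u. trace_on UNIV (\<lambda>w. br u (br u w)) \<ge> 0"
begin

text \<open>The pairings with \<open>E\<close> and with \<open>e\<close> vanish on frame vectors and
  extend to \<open>U\<close> one argument at a time, so only the \<open>e\<close>-coefficient
  remains. This is the abelian quotient \<open>e\<^sup>\<bottom> / \<real>e\<close>.\<close>

lemma br_U_U:
  assumes u: "u \<in> U" and v: "v \<in> U"
  shows "br u v = B (br u v) h *\<^sub>R e"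
proof -
  have EE: "B (br i j) z = 0" if "i \<in> E" "j \<in> E" "z \<in> insert e E" for i j z
    using that br_E_vanishing(1)[OF pos] br_E_E_e by auto
  have EU: "B (br i v) z = 0" if "i \<in> E" "z \<in> insert e E" for i z
    by (rule linear_eq_on_U[where f = "\<lambda>v. B (br i v) z" and g = "\<lambda>_. 0", OF _ _ _ v])
      (use EE that in \<open>auto intro!: linearI simp: B_lin br_lin\<close>)
  have "B (br u v) z = 0" if "z \<in> insert e E" for z
    by (rule linear_eq_on_U[where f = "\<lambda>u. B (br u v) z" and g = "\<lambda>_. 0", OF _ _ _ u])
      (use EU that in \<open>auto intro!: linearI simp: B_lin br_lin\<close>)
  then show ?thesis using expand[of "br u v"] by simp
qed

text \<open>The \<open>h\<close>-coefficient \<open>B (br h u) e\<close> vanishes; this is what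
  makes \<open>e\<^sup>\<bottom>\<close> an ideal.\<close>

lemma br_h_U:
  assumes u: "u \<in> U"
  shows "br h u = B (br h u) h *\<^sub>R e + D u"
proof -
  have "B (br h u) e = 0"
    by (rule linear_eq_on_U[where f = "\<lambda>u. B (br h u) e" and g = "\<lambda>_. 0", OF _ _ _ u])
      (use br_E_vanishing(2)[OF pos] B_br_skew[of h _ e] in
        \<open>auto intro!: linearI simp: B_lin br_lin\<close>)
  then show ?thesis by (simp add: D_def P_def)
qed

text \<open>Here \<open>\<mu> = 0\<close> because \<open>e\<close> is central. Expanding a bracket
  in the splitting by \<open>e\<close>, \<open>U\<close> and \<open>h\<close> leaves only terms
  covered by \<open>br_U_U\<close> and \<open>br_h_U\<close>.\<close>

lemma \<phi>_isometric_iso: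
  "isometric_iso_on UNIV br B (dext_carrier U) (dext_br B (\<lambda>_ _. 0) K D 0 b) (dext_form B) \<phi>"
proof -
  have "bij_betw \<phi> UNIV (dext_carrier U)"
  proof (rule bij_betwI')
    fix x y
    show "\<phi> x = \<phi> y \<longleftrightarrow> x = y" by (auto simp: \<phi>_def P_def)
    show "\<phi> x \<in> dext_carrier U" using P_in_U by (simp add: \<phi>_def dext_carrier_def)
  next
    fix y assume "y \<in> dext_carrier U"
    then obtain s u t where y: "y = (s, u, t)" and u: "u \<in> U" by (auto simp: dext_carrier_def)
    have "y = \<phi> (s *\<^sub>R e + u + t *\<^sub>R h)"
      using u by (simp add: y \<phi>_def P_def U_def B_lin B_ee B_hh B_eh B_sym[of h e])
    then show "\<exists>x\<in>UNIV. y = \<phi> x" by blast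
  qed
  moreover have "\<phi> (x + y) = \<phi> x + \<phi> y" "\<phi> (c *\<^sub>R x) = c *\<^sub>R \<phi> x" for x y c
    by (simp_all add: \<phi>_def B_lin linear_add[OF P_linear] linear_scale[OF P_linear])
  moreover have "\<phi> (br x y) = dext_br B (\<lambda>_ _. 0) K D 0 b (\<phi> x) (\<phi> y)" for x y
  proof -
    define u where "u = P x"
    define v where "v = P y"
    define s where "s = B x e"
    define t where "t = B y e"
    have u: "u \<in> U" and v: "v \<in> U" using P_in_U by (auto simp: u_def v_def)
    have "br x y = br (B x h *\<^sub>R e + u + s *\<^sub>R h) (B y h *\<^sub>R e + v + t *\<^sub>R h)"
      by (simp add: u_def v_def s_def t_def P_def)
    also have "\<dots> = br u v + s *\<^sub>R br h v - t *\<^sub>R br h u"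
      using br_skew[of u h] by (simp add: br_lin central central' br_h_h)
    also have "\<dots> = (B (br u v) h + s * B (br h v) h - t * B (br h u) h) *\<^sub>R e
        + (s *\<^sub>R D v - t *\<^sub>R D u)"
      by (subst br_U_U[OF u v], subst br_h_U[OF u], subst br_h_U[OF v]) (simp add: algebra_simps)
    also have "\<dots> = (s * B b v - t * B b u + B (K u) v) *\<^sub>R e + (s *\<^sub>R D v - t *\<^sub>R D u)"
      by (simp add: B_b B_K u v algebra_simps)
    finally have br: "br x y = \<dots>" .
    have "s *\<^sub>R D v - t *\<^sub>R D u \<in> U"
      using u v endo_D subspace_U by (auto simp: endo_on_def intro: subspace_diff subspace_scale)
    moreover have "\<phi> (r *\<^sub>R e + w) = (r, w, 0)" if "w \<in> U" for r w
      using that by (simp add: \<phi>_def P_def U_def B_lin B_ee B_eh)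
    ultimately have "\<phi> (br x y) = (s * B b v - t * B b u + B (K u) v, s *\<^sub>R D v - t *\<^sub>R D u, 0)"
      unfolding br by blast
    moreover have "\<phi> x = (B x h, u, s)" "\<phi> y = (B y h, v, t)"
      by (simp_all add: \<phi>_def u_def v_def s_def t_def)
    ultimately show ?thesis by (simp add: dext_br_def)
  qed
  moreover have "dext_form B (\<phi> x) (\<phi> y) = B x y" for x y
    by (simp add: dext_form_def \<phi>_def P_def B_lin B_ee B_hh B_eh B_sym[of h e] B_sym[of _ y])
  ultimately show ?thesis by (simp add: isometric_iso_on_def)
qed

text \<open>The Lie, Lorentzian and Einstein conditions are carried over along
  \<open>\<phi>\<close>, so no identity between \<open>K\<close> and \<open>D\<close> has to be
  computed.\<close>

lemma admissible_double_extension: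
  assumes "lie_algebra_on UNIV br" "lorentzian_on UNIV B"
  shows "admissible U B K D 0 b"
  unfolding admissible_def
  using endo_K endo_D K_skew sum_E_in_U lie_algebra_transport[OF assms(1) \<phi>_isometric_iso]
    lorentzian_transport[OF assms(2) \<phi>_isometric_iso] einstein_transport[OF \<phi>_isometric_iso] einstein
  by (auto simp: b_def einstein_on_def)

end

end

section \<open>Existence of a null frame, and the theorem\<close>

lemma null_frame_exists:
  fixes br :: "'a::euclidean_space \<Rightarrow> 'a \<Rightarrow> 'a" and B :: "'a \<Rightarrow> 'a \<Rightarrow> real"
  assumes br: "bilinear br" "\<And>x y. br x y = - br y x"
    and L: "lorentzian_on UNIV B" and e: "e \<noteq> 0" "B e e = 0"
  obtains h E where "null_frame br B e h E"
proof -
  have B: "bilinear B" "B x y = B y x" for x y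
    using L by (auto simp: lorentzian_on_def sym_form_on_def bilinear_on_UNIV)
  note lin = bilinear_ladd[OF B(1)] bilinear_radd[OF B(1)] bilinear_lmul[OF B(1)] bilinear_rmul[OF B(1)]
    bilinear_lsub[OF B(1)] bilinear_rsub[OF B(1)]
  have "\<forall>x. (\<forall>w. B x w = 0) \<longrightarrow> x = 0"
    using lorentzian_coords[OF L] by (elim exE conjE)
  then obtain w where w: "B e w \<noteq> 0" using e(1) by blast
  \<comment> \<open>Subtracting a multiple of \<open>e\<close> makes \<open>w\<close> null and
    leaves its pairing with \<open>e\<close> unchanged; the factor normalises that pairing.\<close>
  define h where "h = (1 / B e w) *\<^sub>R (w - (B w w / (2 * B e w)) *\<^sub>R e)"
  have h: "B e h = 1" "B h h = 0" "B h e = 1"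
    using w e(2) B(2)[of w e] by (auto simp: h_def lin field_simps)
  let ?U = "{x. B x e = 0 \<and> B x h = 0}"
  have U: "subspace ?U" by (auto simp: subspace_def lin bilinear_lzero[OF B(1)])
  have "B x x > 0" if "x \<in> ?U" "x \<noteq> 0" for x
    \<comment> \<open>\<open>e - h\<close> is timelike, its square being \<open>-2\<close>, and it
      is orthogonal to \<open>?U\<close>.\<close>
    using that e(2) h B(2)[of x] by (intro lorentzian_pos_of_orthogonal_timelike[OF L, of "e - h"]) (auto simp: lin)
  from orthonormal_basis_of_form[OF B U this]
  obtain E where E: "finite E" "E \<subseteq> ?U" "\<And>x y. x \<in> E \<Longrightarrow> y \<in> E \<Longrightarrow> B x y = (if x = y then 1 else 0)"
    "\<And>v. v \<in> ?U \<Longrightarrow> v = (\<Sum>x\<in>E. B v x *\<^sub>R x)" by blast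
  have expand: "v = B v h *\<^sub>R e + B v e *\<^sub>R h + (\<Sum>x\<in>E. B v x *\<^sub>R x)" for v
  proof -
    let ?u = "v - B v h *\<^sub>R e - B v e *\<^sub>R h"
    have "?u \<in> ?U" using h e(2) by (simp add: lin)
    then have "?u = (\<Sum>x\<in>E. B ?u x *\<^sub>R x)" by (rule E(4))
    also have "\<dots> = (\<Sum>x\<in>E. B v x *\<^sub>R x)"
      using E(2) B(2)[of e] B(2)[of h] by (intro sum.cong) (auto simp: lin)
    finally show ?thesis by (simp add: algebra_simps)
  qed
  have "null_frame br B e h E"
  proof unfold_locales
    show "B x e = 0" "B x h = 0" if "x \<in> E" for x using that E(2) by auto
  qed (fact br B e(2) h E expand)+
  then show ?thesis by (rule that)
qed

theorem theorem4p4: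
  fixes br :: "'a::euclidean_space \<Rightarrow> 'a \<Rightarrow> 'a" and B :: "'a \<Rightarrow> 'a \<Rightarrow> real"
  assumes "lie_algebra_on UNIV br"
    and "lorentzian_on UNIV B"
    and "completely_solvable_on UNIV br"
    and "unimodular_on UNIV br"
    and "center_on UNIV br \<noteq> {0}"
    and "degenerate_on (center_on UNIV br) B"
  shows "(einstein_on UNIV br B \<longleftrightarrow>
            (\<exists>(U::'a set) ip0 K D b. subspace U \<and> euclidean_form_on U ip0 \<and>
               admissible U ip0 K D 0 b \<and>
               (\<exists>\<phi>. isometric_iso_on UNIV br B (dext_carrier U) (dext_br ip0 (\<lambda>_ _. 0) K D 0 b)
                       (dext_form ip0) \<phi>)))
         \<and> (einstein_on UNIV br B \<longrightarrow> ricci_flat_on UNIV br B)"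
    (is "(_ \<longleftrightarrow> ?ext) \<and> _")
proof -
  have br: "bilinear br" "br x y = - br y x" for x y
    using assms(1) unfolding lie_algebra_on_def bilinear_on_UNIV by blast+
  \<comment> \<open>Degeneracy yields a nonzero central vector orthogonal to the whole center, hence
    to itself.\<close>
  obtain e where e: "e \<noteq> 0" "B e e = 0" "\<And>x. br e x = 0"
    using assms(6) by (auto simp: degenerate_on_def center_on_def)
  obtain h E where "null_frame br B e h E"
    using null_frame_exists[OF br assms(2) e(1,2)] .
  then interpret null_frame br B e h E .
  have "?ext \<and> ricci_flat_on UNIV br B" if ein: "einstein_on UNIV br B"
  proof -
    obtain c where c: "\<And>u. ricci_op UNIV br B u = c *\<^sub>R u"
      using ein by (auto simp: einstein_on_def)
    interpret einstein_null_frame br B e h E c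
      by unfold_locales (use assms(4) e(3) c in \<open>auto simp: unimodular_on_def\<close>)
    obtain I where I: "I 0 = {0}" "I DIM('a) = UNIV"
      "\<And>i. i \<le> DIM('a) \<Longrightarrow> is_ideal UNIV br (I i) \<and> dim (I i) = i"
      "\<And>i. i < DIM('a) \<Longrightarrow> I i \<subseteq> I (Suc i)"
      using assms(3) by (auto simp: completely_solvable_on_def)
    have pos: "trace_on UNIV (\<lambda>w. br u (br u w)) \<ge> 0" for u
      by (rule trace_square_nonneg_of_flag[OF br_linear(1), of I])
        (use I in \<open>auto simp: is_ideal_def\<close>)
    show ?thesis
      using subspace_U euclidean_form_U admissible_double_extension[OF pos assms(1,2)]
        \<phi>_isometric_iso[OF pos] ricci_flat by blast
  qed
  \<comment> \<open>The frame was obtained without the Einstein condition, so transport is available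
    here; admissibility supplies the Einstein extension.\<close>
  moreover have "einstein_on UNIV br B" if ?ext
    using that einstein_transport by (auto simp: admissible_def)
  ultimately show ?thesis by blast
qed

end
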